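(* The notion of a PC domain is incomparable with the notion of a pre-Schreier domain, and hence also with the notions of a Schreier domain and of a GCD domain. That is, for each of the three properties $\mathcal{P}\in\{\text{pre-Schreier},\ \text{Schreier},\ \text{GCD}\}$ of integral domains, there exists a PC domain which does not have property $\mathcal{P}$, and there exists an integral domain which has property $\mathcal{P}$ but is not a PC domain.
   Context: All rings are integral domains (commutative with identity). An ideal is two-generated if it equals $(a,b)$ for some elements $a,b$ of the ring. A PC domain is an integral domain in which every proper two-generated ideal is contained in a proper principal ideal. An element $c$ of an integral domain $D$ is primal if for all $a,b\in D$ with $c\mid ab$ there exist $c_1,c_2\in D$ with $c=c_1c_2$, $c_1\mid a$ and $c_2\mid b$. An integral domain is pre-Schreier if each of its elements is primal, and Schreier if it is integrally closed and each of its elements is primal. A GCD domain is an integral domain in which every two elements have a greatest common divisor. *)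

theory Defs
  imports Complex_Main "HOL-Algebra.Algebra"
begin

subsection \<open>PC domains\<close>

definition two_generated_ideal :: "'a set \<Rightarrow> ('a, 'm) ring_scheme \<Rightarrow> bool" where
  "two_generated_ideal I R \<longleftrightarrow>
     (\<exists>a\<in>carrier R. \<exists>b\<in>carrier R. I = genideal R {a, b})"

definition PC_domain :: "('a, 'm) ring_scheme \<Rightarrow> bool" where
  "PC_domain R \<longleftrightarrow> domain R \<and>
     (\<forall>I. two_generated_ideal I R \<and> I \<noteq> carrier R \<longrightarrow>
        (\<exists>J. principalideal J R \<and> J \<noteq> carrier R \<and> I \<subseteq> J))"

subsection \<open>Pre-Schreier domains and GCD domains\<close>

definition primal :: "('a, 'm) ring_scheme \<Rightarrow> 'a \<Rightarrow> bool" where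
  "primal R c \<longleftrightarrow>
     (\<forall>a\<in>carrier R. \<forall>b\<in>carrier R. c divides\<^bsub>R\<^esub> (a \<otimes>\<^bsub>R\<^esub> b) \<longrightarrow>
        (\<exists>c1\<in>carrier R. \<exists>c2\<in>carrier R.
           c = c1 \<otimes>\<^bsub>R\<^esub> c2 \<and> c1 divides\<^bsub>R\<^esub> a \<and> c2 divides\<^bsub>R\<^esub> b))"

definition pre_Schreier_domain :: "('a, 'm) ring_scheme \<Rightarrow> bool" where
  "pre_Schreier_domain R \<longleftrightarrow> domain R \<and> (\<forall>c\<in>carrier R. primal R c)"

definition GCD_domain :: "('a, 'm) ring_scheme \<Rightarrow> bool" where
  "GCD_domain R \<longleftrightarrow> domain R \<and>
     (\<forall>a\<in>carrier R. \<forall>b\<in>carrier R. \<exists>d\<in>carrier R. d gcdof\<^bsub>R\<^esub> a b)"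

subsection \<open>Field of fractions, integral closure and Schreier domains\<close>

text \<open>
  The field of fractions is built as in HOL-Computational_Algebra's \<open>Fraction_Field\<close>,
  but for carrier-based rings: fractions are classes of pairs under cross-multiplication.
  The unions below range over representatives and collapse to a single class when
  \<open>R\<close> is a domain.
\<close>

definition fraction_rel :: "('a, 'm) ring_scheme \<Rightarrow> (('a \<times> 'a) \<times> ('a \<times> 'a)) set" where
  "fraction_rel R = {((a, b), (c, d)).
     a \<in> carrier R \<and> b \<in> carrier R - {\<zero>\<^bsub>R\<^esub>} \<and>
     c \<in> carrier R \<and> d \<in> carrier R - {\<zero>\<^bsub>R\<^esub>} \<and> a \<otimes>\<^bsub>R\<^esub> d = c \<otimes>\<^bsub>R\<^esub> b}"

definition fraction :: "('a, 'm) ring_scheme \<Rightarrow> 'a \<Rightarrow> 'a \<Rightarrow> ('a \<times> 'a) set" where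
  "fraction R a b = fraction_rel R `` {(a, b)}"

definition fraction_field :: "('a, 'm) ring_scheme \<Rightarrow> ('a \<times> 'a) set ring" where
  "fraction_field R =
     \<lparr>carrier = (carrier R \<times> (carrier R - {\<zero>\<^bsub>R\<^esub>})) // fraction_rel R,
      monoid.mult = (\<lambda>A B. \<Union>(a, b)\<in>A. \<Union>(c, d)\<in>B. fraction R (a \<otimes>\<^bsub>R\<^esub> c) (b \<otimes>\<^bsub>R\<^esub> d)),
      one = fraction R \<one>\<^bsub>R\<^esub> \<one>\<^bsub>R\<^esub>,
      ring.zero = fraction R \<zero>\<^bsub>R\<^esub> \<one>\<^bsub>R\<^esub>,
      add = (\<lambda>A B. \<Union>(a, b)\<in>A. \<Union>(c, d)\<in>B.
               fraction R ((a \<otimes>\<^bsub>R\<^esub> d) \<oplus>\<^bsub>R\<^esub> (c \<otimes>\<^bsub>R\<^esub> b)) (b \<otimes>\<^bsub>R\<^esub> d))\<rparr>"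

text \<open>\<open>x\<close> is a root of a monic polynomial of degree \<open>n\<close> with lower coefficients \<open>c i\<close> in \<open>A\<close>.\<close>

definition integral_over :: "('a, 'm) ring_scheme \<Rightarrow> 'a set \<Rightarrow> 'a \<Rightarrow> bool" where
  "integral_over K A x \<longleftrightarrow>
     (\<exists>n::nat. \<exists>c. (\<forall>i<n. c i \<in> A) \<and>
        x [^]\<^bsub>K\<^esub> n \<oplus>\<^bsub>K\<^esub> (\<Oplus>\<^bsub>K\<^esub>i\<in>{..<n}. c i \<otimes>\<^bsub>K\<^esub> x [^]\<^bsub>K\<^esub> i) = \<zero>\<^bsub>K\<^esub>)"

definition integrally_closed :: "('a, 'm) ring_scheme \<Rightarrow> bool" where
  "integrally_closed R \<longleftrightarrow>
     (let D = (\<lambda>a. fraction R a \<one>\<^bsub>R\<^esub>) ` carrier R in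
      \<forall>x\<in>carrier (fraction_field R). integral_over (fraction_field R) D x \<longrightarrow> x \<in> D)"

definition Schreier_domain :: "('a, 'm) ring_scheme \<Rightarrow> bool" where
  "Schreier_domain R \<longleftrightarrow>
     domain R \<and> integrally_closed R \<and> (\<forall>c\<in>carrier R. primal R c)"

end

(* A PC domain that is not pre-Schreier is the ring of real power series with integral constant
   term and no linear term. A series with constant term 1 is a unit in it, and a nonzero integer
   divides every series whose constant term it divides. So a proper ideal (f, g) lies in (d), where
   d is the gcd of the constant terms (or 2 when both vanish). On the other hand there is no element
   of order 1, so X^2 divides X^3 X^3 but is not primal, and X^5 and X^6 have no gcd.
   Conversely the integer polynomials form a GCD domain, hence a Schreier domain, while the proper
   ideal (2, X) lies in no proper principal ideal. *)
theory Submission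
  imports Defs
    "HOL-Computational_Algebra.Polynomial_Factorial"
    "HOL-Computational_Algebra.Formal_Power_Series"
begin

section \<open>Copies of subrings of type class domains\<close>

text \<open>The examples must be carrier-based rings on \<open>nat \<Rightarrow> real\<close>, while
  the calculations belong to type class domains. The injection \<open>e\<close> carries a subring
  \<open>S\<close> over, so that questions about \<open>R\<close> turn into identities in
  \<open>'b\<close>.\<close>

locale ring_copy =
  fixes e :: "'b::idom \<Rightarrow> 'a" and S :: "'b set" and R :: "('a, 'm) ring_scheme" (structure)
  assumes inj: "inj e"
    and carrier_eq: "carrier R = e ` S"
    and zero_eq: "\<zero> = e 0"
    and one_eq: "\<one> = e 1"
    and add_eq: "\<And>x y. x \<in> S \<Longrightarrow> y \<in> S \<Longrightarrow> e x \<oplus> e y = e (x + y)"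
    and mult_eq: "\<And>x y. x \<in> S \<Longrightarrow> y \<in> S \<Longrightarrow> e x \<otimes> e y = e (x * y)"
    and zero_in: "0 \<in> S"
    and one_in: "1 \<in> S"
    and uminus_in: "\<And>x. x \<in> S \<Longrightarrow> - x \<in> S"
    and add_in: "\<And>x y. x \<in> S \<Longrightarrow> y \<in> S \<Longrightarrow> x + y \<in> S"
    and mult_in: "\<And>x y. x \<in> S \<Longrightarrow> y \<in> S \<Longrightarrow> x * y \<in> S"
begin

lemma eq_iff: "e x = e y \<longleftrightarrow> x = y"
  using inj by (simp add: inj_eq)

lemma mem_carrier_iff: "e x \<in> carrier R \<longleftrightarrow> x \<in> S"
  by (auto simp: carrier_eq eq_iff)

lemma domain: "domain R"
proof -
  have "cring R"
  proof (rule cringI)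
    show "abelian_group R"
    proof (rule abelian_groupI)
      fix x assume "x \<in> carrier R"
      then obtain a where a: "a \<in> S" "x = e a"
        by (auto simp: carrier_eq)
      then have "e (- a) \<in> carrier R" "e (- a) \<oplus> x = \<zero>"
        by (simp_all add: mem_carrier_iff add_eq zero_eq uminus_in)
      then show "\<exists>y\<in>carrier R. y \<oplus> x = \<zero>"
        by blast
    qed (auto simp: carrier_eq zero_eq zero_in add_eq add_in ac_simps)
    show "comm_monoid R"
      by (rule comm_monoidI) (auto simp: carrier_eq one_eq one_in mult_eq mult_in ac_simps)
  qed (auto simp: carrier_eq add_eq add_in mult_eq mult_in distrib_right)
  then show ?thesis
    by (rule domain.intro) (unfold_locales, auto simp: carrier_eq zero_eq one_eq mult_eq eq_iff)
qed

lemma divides_iff: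
  assumes "x \<in> S"
  shows "e x divides e y \<longleftrightarrow> (\<exists>z\<in>S. y = x * z)"
  using assms by (auto simp: factor_def carrier_eq mult_eq eq_iff)

text \<open>Membership of the sum in \<open>S\<close> is proved along with the equation because the
  induction step applies \<open>add_eq\<close>, which asks for it.\<close>

lemma finsum:
  fixes n :: nat
  assumes "\<And>i. i < n \<Longrightarrow> f i \<in> S"
  shows "(\<Oplus>i\<in>{..<n}. e (f i)) = e (sum f {..<n}) \<and> sum f {..<n} \<in> S"
proof -
  interpret domain R by (rule domain)
  show ?thesis
    using assms
  proof (induction n)
    case 0
    then show ?case by (simp add: zero_eq zero_in)
  next
    case (Suc n)
    have "(\<Oplus>i\<in>insert n {..<n}. e (f i)) = e (f n) \<oplus> (\<Oplus>i\<in>{..<n}. e (f i))"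
      using Suc.prems by (intro finsum_insert) (auto simp: mem_carrier_iff)
    then show ?case
      using Suc by (simp add: lessThan_Suc add_eq add_in)
  qed
qed

lemma nat_pow:
  assumes "x \<in> S"
  shows "e x [^] (n::nat) = e (x ^ n) \<and> x ^ n \<in> S"
proof -
  interpret domain R by (rule domain)
  show ?thesis
    using assms by (induction n) (simp_all add: one_eq one_in mult_eq mult_in mult.commute)
qed

lemma ideal_image:
  assumes "T \<subseteq> S" "0 \<in> T" "\<And>x y. x \<in> T \<Longrightarrow> y \<in> T \<Longrightarrow> x + y \<in> T"
    and "\<And>x y. x \<in> S \<Longrightarrow> y \<in> T \<Longrightarrow> x * y \<in> T"
  shows "ideal (e ` T) R"
proof -
  interpret domain R by (rule domain)
  show ?thesis
  proof (rule idealI)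
    show "ring R" by (rule ring_axioms)
    show "subgroup (e ` T) (add_monoid R)"
    proof (rule add.subgroupI)
      fix x assume "x \<in> e ` T"
      then obtain a where a: "a \<in> T" "x = e a"
        by blast
      \<comment> \<open>Closure under negation follows from absorption, since \<open>- 1\<close>
        lies in \<open>S\<close>.\<close>
      have "- 1 * a \<in> T"
        using assms(4) a(1) one_in uminus_in by blast
      then have minus: "- a \<in> T"
        by simp
      have "\<ominus> x = e (- a)"
      proof (rule minus_equality)
        show "e (- a) \<oplus> x = \<zero>"
          using a minus assms(1) by (simp add: add_eq zero_eq subset_iff)
      qed (use a minus assms(1) in \<open>auto simp: mem_carrier_iff\<close>)
      then show "\<ominus> x \<in> e ` T"
        using minus by simp
    next
      fix x y assume "x \<in> e ` T" "y \<in> e ` T"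
      then obtain a b where "a \<in> T" "x = e a" "b \<in> T" "y = e b"
        by blast
      then show "x \<oplus> y \<in> e ` T"
        using assms(1,3) by (simp add: add_eq subset_iff)
    qed (use assms in \<open>auto simp: mem_carrier_iff\<close>)
  next
    fix x y assume "x \<in> e ` T" "y \<in> carrier R"
    then obtain a b where ab: "a \<in> T" "x = e a" "b \<in> S" "y = e b"
      by (auto simp: carrier_eq)
    then show "y \<otimes> x \<in> e ` T"
      using assms by (simp add: mult_eq subset_iff)
    show "x \<otimes> y \<in> e ` T"
      using ab assms by (simp add: mult_eq subset_iff mult.commute[of a b])
  qed
qed

end

text \<open>The operations are transported along \<open>the_inv e\<close>, so they behave as
  intended only on the range of \<open>e\<close>; the subring \<open>S\<close> enters through the
  carrier alone.\<close>

definition copy_ring :: "('b::idom \<Rightarrow> 'a) \<Rightarrow> 'b set \<Rightarrow> 'a ring" where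
  "copy_ring e S = \<lparr>carrier = e ` S, monoid.mult = (\<lambda>x y. e (the_inv e x * the_inv e y)), one = e 1,
     ring.zero = e 0, add = (\<lambda>x y. e (the_inv e x + the_inv e y))\<rparr>"

lemma ring_copy_copy_ring:
  assumes "inj e" "0 \<in> S" "1 \<in> S" "\<And>x. x \<in> S \<Longrightarrow> - x \<in> S"
    and "\<And>x y. x \<in> S \<Longrightarrow> y \<in> S \<Longrightarrow> x + y \<in> S"
    and "\<And>x y. x \<in> S \<Longrightarrow> y \<in> S \<Longrightarrow> x * y \<in> S"
  shows "ring_copy e S (copy_ring e S)"
  by unfold_locales (use assms in \<open>simp_all add: copy_ring_def the_inv_f_f\<close>)

section \<open>GCD domains are Schreier domains\<close>

text \<open>Cross-multiplication is the criterion for equality in \<open>'b fract\<close>, so each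
  class of pairs is a fibre of \<open>Fract\<close>.\<close>

lemma (in ring_copy) fraction_eq:
  assumes "S = UNIV" "b \<noteq> 0"
  shows "fraction R (e a) (e b) = {(e c, e d) |c d. d \<noteq> 0 \<and> Fract c d = Fract a b}"
  using assms
  by (auto simp: fraction_def fraction_rel_def carrier_eq zero_eq eq_iff mult_eq eq_fract)

text \<open>An element of the field of fractions, as a type, corresponds to the set of all pairs
  representing it.\<close>

lemma (in ring_copy) ring_copy_fraction_field:
  assumes "S = UNIV"
  shows "ring_copy (\<lambda>q. {(e c, e d) |c d. d \<noteq> 0 \<and> Fract c d = q}) UNIV (fraction_field R)"
    (is "ring_copy ?E UNIV ?F")
proof
  have nonempty: "?E q \<noteq> {}" for q
    by (cases q) auto
  have frac: "fraction R (e a) (e b) = ?E (Fract a b)" if "b \<noteq> 0" for a b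
    using fraction_eq[OF assms that] .
  have one_nz: "(1::'b) \<noteq> 0"
    by simp
  show "inj ?E"
  proof (rule injI)
    fix p q assume "?E p = ?E q"
    moreover obtain x where x: "x \<in> ?E p"
      using nonempty[of p] by blast
    ultimately have "x \<in> ?E q"
      by simp
    with x show "p = q"
      by (auto simp: eq_iff)
  qed
  show "carrier ?F = range ?E"
  proof -
    have "carrier R \<times> (carrier R - {\<zero>}) = {(e a, e b) |a b. b \<noteq> 0}"
      by (auto simp: carrier_eq assms zero_eq eq_iff)
    then have "carrier ?F = {fraction R (e a) (e b) |a b. b \<noteq> 0}"
      by (auto simp: fraction_field_def quotient_def fraction_def)
    also have "\<dots> = {?E (Fract a b) |a b. b \<noteq> 0}"
      using frac by (metis (no_types, lifting))
    also have "\<dots> = range ?E"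
    proof
      show "range ?E \<subseteq> {?E (Fract a b) |a b. b \<noteq> 0}"
      proof
        fix x assume "x \<in> range ?E"
        then obtain q where q: "x = ?E q"
          by blast
        obtain a b where "q = Fract a b" "b \<noteq> 0"
          by (cases q)
        with q show "x \<in> {?E (Fract a b) |a b. b \<noteq> 0}"
          by blast
      qed
    qed blast
    finally show ?thesis .
  qed
  show "\<zero>\<^bsub>?F\<^esub> = ?E 0"
    using frac[OF one_nz, of 0] by (simp add: fraction_field_def zero_eq one_eq Zero_fract_def)
  show "\<one>\<^bsub>?F\<^esub> = ?E 1"
    using frac[OF one_nz, of 1] by (simp add: fraction_field_def one_eq One_fract_def)
  fix p q
  \<comment> \<open>The operations of \<open>fraction_field\<close> are unions over all
    representatives. Since both index sets are nonempty, such a union collapses as soon as every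
    pair of representatives yields the same class.\<close>
  have UN_const: "(\<Union>(a, b)\<in>?E p. \<Union>(c, d)\<in>?E q. G a b c d) = C"
    if "\<And>a b c d. b \<noteq> 0 \<Longrightarrow> d \<noteq> 0 \<Longrightarrow> p = Fract a b \<Longrightarrow> q = Fract c d \<Longrightarrow>
      G (e a) (e b) (e c) (e d) = C" for C and G :: "_ \<Rightarrow> _ \<Rightarrow> _ \<Rightarrow> _ \<Rightarrow> ('a \<times> 'a) set"
    by (rule SUP_eq_const[OF nonempty], clarify, rule SUP_eq_const[OF nonempty], clarify)
      (rule that; simp)
  have add_F: "A \<oplus>\<^bsub>?F\<^esub> B = (\<Union>(a, b)\<in>A. \<Union>(c, d)\<in>B. fraction R (a \<otimes> d \<oplus> c \<otimes> b) (b \<otimes> d))"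
    and mult_F: "A \<otimes>\<^bsub>?F\<^esub> B = (\<Union>(a, b)\<in>A. \<Union>(c, d)\<in>B. fraction R (a \<otimes> c) (b \<otimes> d))" for A B
    by (simp_all add: fraction_field_def)
  show "?E p \<oplus>\<^bsub>?F\<^esub> ?E q = ?E (p + q)"
    unfolding add_F by (rule UN_const) (simp add: assms mult_eq add_eq frac)
  show "?E p \<otimes>\<^bsub>?F\<^esub> ?E q = ?E (p * q)"
    unfolding mult_F by (rule UN_const) (simp add: assms mult_eq frac)
qed auto

section \<open>Integral elements of the field of fractions of a ring with gcds\<close>

lemma fract_coprime_cases:
  fixes q :: "'b::{idom,ring_gcd} fract"
  obtains a b where "q = Fract a b" "b \<noteq> 0" "coprime a b"
proof (cases q)
  case (Fract a b)
  then obtain a' b' where *: "a = a' * gcd a b" "b = b' * gcd a b" "coprime a' b'"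
    using gcd_coprime_exists[of a b] by auto
  have "gcd a b \<noteq> 0"
    using Fract by simp
  moreover have "b' \<noteq> 0"
    using * Fract by auto
  moreover have "Fract a b = Fract a' b'"
    using \<open>b' \<noteq> 0\<close> Fract(2) *(1,2)
    by (simp add: eq_fract) (metis mult.assoc mult.commute)
  ultimately show thesis
    using that * Fract by metis
qed

text \<open>This is the rational root argument: with \<open>q\<close> in lowest terms
  \<open>a / b\<close>, multiplying the monic equation by \<open>b ^ n\<close> shows that
  \<open>b\<close> divides \<open>a ^ n\<close>, so \<open>b\<close> is a unit.\<close>

lemma integral_fract_in_range:
  fixes q :: "'b::{idom,ring_gcd} fract"
  assumes "q ^ n + (\<Sum>i<n. Fract (c i) 1 * q ^ i) = 0"
  shows "\<exists>a. q = Fract a 1"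
proof -
  obtain a b where q: "q = Fract a b" "b \<noteq> 0" "coprime a b"
    by (rule fract_coprime_cases)
  have to_fract: "Fract a 1 = q * Fract b 1"
    using q by (simp add: eq_fract)
  have mult1: "Fract (x * y) 1 = Fract x 1 * Fract y 1" for x y :: 'b
    by simp
  have pow: "Fract (x ^ k) 1 = Fract x 1 ^ k" for x :: 'b and k
    by (induction k) (simp_all only: power_0 power_Suc mult1 One_fract_def)
  have add1: "Fract (x + y) 1 = Fract x 1 + Fract y 1" for x y :: 'b
    by simp
  have sum1: "Fract (sum f A) 1 = (\<Sum>i\<in>A. Fract (f i) 1)" for f :: "nat \<Rightarrow> 'b" and A
    by (induction A rule: infinite_finite_induct)
      (simp_all only: sum.infinite sum.empty sum.insert add1 Zero_fract_def not_False_eq_True)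
  let ?B = "Fract b 1"
  have "Fract (a ^ n + (\<Sum>i<n. c i * a ^ i * b ^ (n - i))) 1
      = (q * ?B) ^ n + (\<Sum>i<n. Fract (c i) 1 * (q * ?B) ^ i * ?B ^ (n - i))"
    by (simp only: add1 sum1 mult1 pow to_fract)
  also have "(\<Sum>i<n. Fract (c i) 1 * (q * ?B) ^ i * ?B ^ (n - i))
      = (\<Sum>i<n. Fract (c i) 1 * q ^ i * ?B ^ n)"
  proof (rule sum.cong)
    fix i assume "i \<in> {..<n}"
    then have "?B ^ n = ?B ^ i * ?B ^ (n - i)"
      by (simp flip: power_add)
    then show "Fract (c i) 1 * (q * ?B) ^ i * ?B ^ (n - i) = Fract (c i) 1 * q ^ i * ?B ^ n"
      by (simp add: power_mult_distrib mult.assoc)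
  qed simp
  also have "(q * ?B) ^ n + \<dots> = (q ^ n + (\<Sum>i<n. Fract (c i) 1 * q ^ i)) * ?B ^ n"
    by (simp add: power_mult_distrib distrib_right sum_distrib_right)
  also have "\<dots> = Fract 0 1"
    unfolding assms mult_zero_left by (rule Zero_fract_def)
  finally have "Fract (a ^ n + (\<Sum>i<n. c i * a ^ i * b ^ (n - i))) 1 = Fract 0 1" .
  then have "a ^ n = - (\<Sum>i<n. c i * a ^ i * b ^ (n - i))"
    by (simp add: eq_fract eq_neg_iff_add_eq_0)
  \<comment> \<open>Every index satisfies \<open>i < n\<close>, so the exponent \<open>n - i\<close>
    is positive.\<close>
  moreover have "b dvd (\<Sum>i<n. c i * a ^ i * b ^ (n - i))"
    by (intro dvd_sum dvd_mult) (auto intro: dvd_power)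
  ultimately have "b dvd a ^ n"
    by simp
  moreover have "coprime (a ^ n) b"
    using q by simp
  ultimately have "is_unit b"
    using coprime_common_divisor[of "a ^ n" b b] by simp
  then obtain u where "b * u = 1"
    by (metis dvdE)
  then have "q = Fract (a * u) 1"
    using q by (simp add: eq_fract ac_simps)
  then show ?thesis
    by blast
qed

text \<open>Taking all of \<open>'b\<close> as the subring ensures that no quotient falls outside
  the carrier. Divisibility in \<open>R\<close> is then \<open>dvd\<close>, and gcds transfer
  directly.\<close>

locale gcd_ring_copy = ring_copy e UNIV R
  for e :: "'b::{idom,ring_gcd} \<Rightarrow> 'a" and R :: "('a, 'm) ring_scheme" (structure)
begin

lemma divides_iff_dvd: "e x divides e y \<longleftrightarrow> x dvd y"
  by (simp add: divides_iff dvd_def)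

lemma GCD_domain: "GCD_domain R"
proof -
  have "e (gcd x y) gcdof\<^bsub>R\<^esub> e x e y" for x y
    by (auto simp: isgcd_def carrier_eq divides_iff_dvd)
  then show ?thesis
    using domain unfolding GCD_domain_def carrier_eq by blast
qed

text \<open>For nonzero \<open>z\<close> dividing \<open>x * y\<close>, the cofactor of
  \<open>gcd z x\<close> in \<open>z\<close> is coprime to the cofactor in \<open>x\<close>, hence
  divides \<open>y\<close>. The splitting itself is taken from
  \<open>division_decomp\<close>.\<close>

lemma primal:
  assumes "c \<in> carrier R"
  shows "primal R c"
proof -
  have *: "\<exists>c1\<in>carrier R. \<exists>c2\<in>carrier R. e z = c1 \<otimes> c2 \<and> c1 divides e x \<and> c2 divides e y"
    if "z dvd x * y" for x y z
  proof -
    obtain z1 z2 where "z = z1 * z2" "z1 dvd x" "z2 dvd y"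
      using division_decomp[OF \<open>z dvd x * y\<close>] by metis
    then have "e z = e z1 \<otimes> e z2" "e z1 divides e x" "e z2 divides e y"
      by (simp_all add: mult_eq divides_iff_dvd)
    then show ?thesis
      unfolding carrier_eq by blast
  qed
  show ?thesis
    unfolding primal_def
  proof (intro ballI impI)
    fix a b
    assume "a \<in> carrier R" "b \<in> carrier R" "c divides (a \<otimes> b)"
    moreover from this assms obtain x y z where "a = e x" "b = e y" "c = e z"
      unfolding carrier_eq by blast
    ultimately show "\<exists>c1\<in>carrier R. \<exists>c2\<in>carrier R. c = c1 \<otimes> c2 \<and> c1 divides a \<and> c2 divides b"
      using * by (simp add: mult_eq divides_iff_dvd)
  qed
qed

text \<open>The monic equation over \<open>fraction_field R\<close> is pulled back along
  \<open>E\<close> to \<open>'b fract\<close>, where \<open>integral_fract_in_range\<close>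
  applies.\<close>

lemma integrally_closed: "integrally_closed R"
proof -
  obtain E where E: "ring_copy E UNIV (fraction_field R)"
    and frac: "\<And>a. fraction R (e a) (e 1) = E (Fract a 1)"
    using ring_copy_fraction_field[OF refl] fraction_eq[OF refl one_neq_zero] by blast
  interpret F: ring_copy E UNIV "fraction_field R"
    by (rule E)
  interpret FD: Ring.domain "fraction_field R"
    by (rule F.domain)
  have D: "(\<lambda>a. fraction R a \<one>) ` carrier R = range (\<lambda>a. E (Fract a 1))"
    by (simp only: carrier_eq one_eq image_image frac)
  have "x \<in> range (\<lambda>a. E (Fract a 1))"
    if x: "x \<in> carrier (fraction_field R)"
      and int: "integral_over (fraction_field R) (range (\<lambda>a. E (Fract a 1))) x" for x
  proof -
    obtain q where q: "x = E q"
      using x unfolding F.carrier_eq by blast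
    obtain n :: nat and c where c: "\<forall>i<n. c i \<in> range (\<lambda>a. E (Fract a 1))"
      and eq: "x [^]\<^bsub>fraction_field R\<^esub> n \<oplus>\<^bsub>fraction_field R\<^esub>
        (\<Oplus>\<^bsub>fraction_field R\<^esub>i\<in>{..<n}. c i \<otimes>\<^bsub>fraction_field R\<^esub> x [^]\<^bsub>fraction_field R\<^esub> i)
        = \<zero>\<^bsub>fraction_field R\<^esub>"
      using int unfolding integral_over_def by blast
    have "\<forall>i. \<exists>a. i < n \<longrightarrow> c i = E (Fract a 1)"
      using c by blast
    then obtain d where d: "\<And>i. i < n \<Longrightarrow> c i = E (Fract (d i) 1)"
      by metis
    have pow: "x [^]\<^bsub>fraction_field R\<^esub> i = E (q ^ i)" for i :: nat
      unfolding q using F.nat_pow[of q i] by blast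
    have "(\<Oplus>\<^bsub>fraction_field R\<^esub>i\<in>{..<n}. c i \<otimes>\<^bsub>fraction_field R\<^esub> x [^]\<^bsub>fraction_field R\<^esub> i)
        = (\<Oplus>\<^bsub>fraction_field R\<^esub>i\<in>{..<n}. E (Fract (d i) 1 * q ^ i))"
    proof (rule FD.finsum_cong')
      show "(\<lambda>i. E (Fract (d i) 1 * q ^ i)) \<in> {..<n} \<rightarrow> carrier (fraction_field R)"
        unfolding F.carrier_eq by blast
      fix i assume "i \<in> {..<n}"
      then have "c i = E (Fract (d i) 1)"
        using d by blast
      then show "c i \<otimes>\<^bsub>fraction_field R\<^esub> x [^]\<^bsub>fraction_field R\<^esub> i = E (Fract (d i) 1 * q ^ i)"
        by (simp only: pow F.mult_eq[OF UNIV_I UNIV_I])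
    qed simp
    also have "\<dots> = E (\<Sum>i<n. Fract (d i) 1 * q ^ i)"
      using F.finsum[of n "\<lambda>i. Fract (d i) 1 * q ^ i"] by simp
    finally have "E (q ^ n + (\<Sum>i<n. Fract (d i) 1 * q ^ i)) = E 0"
      using eq by (simp only: pow F.add_eq[OF UNIV_I UNIV_I] F.zero_eq)
    then have "q ^ n + (\<Sum>i<n. Fract (d i) 1 * q ^ i) = 0"
      by (rule F.eq_iff[THEN iffD1])
    then obtain a where "q = Fract a 1"
      using integral_fract_in_range by blast
    then show ?thesis
      unfolding q by blast
  qed
  then show ?thesis
    unfolding integrally_closed_def Let_def D by (intro ballI impI)
qed

lemma pre_Schreier_domain: "pre_Schreier_domain R"
  using domain primal by (simp add: pre_Schreier_domain_def)

lemma Schreier_domain: "Schreier_domain R"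
  using domain primal integrally_closed by (simp add: Schreier_domain_def)

end

section \<open>Integer polynomials\<close>

text \<open>A divisor of 2 has degree 0, and a constant dividing X divides its leading coefficient
  1.\<close>

lemma is_unit_if_dvd_2_and_X:
  fixes p :: "int poly"
  assumes "p dvd [:2:]" "p dvd [:0, 1:]"
  shows "is_unit p"
proof -
  have "Polynomial.degree p \<le> Polynomial.degree [:2::int:]"
    using assms(1) by (rule dvd_imp_degree_le) simp
  then obtain c where c: "p = [:c:]"
    by (metis degree_eq_zeroE degree_pCons_0 le_zero_eq)
  then have "c dvd Polynomial.coeff [:0, 1:] 1"
    using assms(2) const_poly_dvd_iff by blast
  then show ?thesis
    by (simp add: c is_unit_const_poly_iff)
qed

lemma not_PC_domain_int_poly:
  fixes e :: "int poly \<Rightarrow> 'a"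
  assumes "gcd_ring_copy e R"
  shows "\<not> PC_domain R"
proof
  interpret gcd_ring_copy e R by (rule assms)
  interpret Ring.domain R by (rule domain)
  let ?I = "genideal R {e [:2:], e [:0, 1:]}"
  assume "PC_domain R"
  moreover have "two_generated_ideal ?I R"
    unfolding two_generated_ideal_def carrier_eq by blast
  moreover have "?I \<noteq> carrier R"
  proof -
    \<comment> \<open>The polynomials with even constant term form an ideal containing 2 and X but
      not 1, so the ideal generated by 2 and X is proper.\<close>
    have "ideal (e ` {p. even (poly p 0)}) R"
      by (rule ideal_image) auto
    then have "?I \<subseteq> e ` {p. even (poly p 0)}"
      by (rule genideal_minimal) auto
    moreover have "\<one>\<^bsub>R\<^esub> \<notin> e ` {p. even (poly p 0)}"
      by (auto simp: one_eq eq_iff)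
    ultimately show ?thesis
      using one_closed by blast
  qed
  ultimately obtain J where J: "principalideal J R" "J \<noteq> carrier R" "?I \<subseteq> J"
    unfolding PC_domain_def by blast
  \<comment> \<open>A generator of \<open>J\<close> is a common divisor of 2 and X, hence a unit,
    which contradicts \<open>J \<noteq> carrier R\<close>.\<close>
  obtain p where p: "J = cgenideal R (e p)"
    using principalideal.generate[OF J(1)] cgenideal_eq_genideal unfolding carrier_eq by blast
  have "{e [:2:], e [:0, 1:]} \<subseteq> ?I"
    by (rule genideal_self) (auto simp: mem_carrier_iff)
  then have "e [:2:] \<in> J" "e [:0, 1:] \<in> J"
    using J(3) by auto
  then have "p dvd [:2:]" "p dvd [:0, 1:]"
    unfolding p cgenideal_def carrier_eq by (auto simp: mult_eq eq_iff)
  then have "p dvd 1"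
    by (rule is_unit_if_dvd_2_and_X)
  then obtain u where "1 = u * p"
    by (metis dvdE mult.commute)
  then have "\<one>\<^bsub>R\<^esub> = e u \<otimes>\<^bsub>R\<^esub> e p"
    by (simp add: one_eq mult_eq)
  then have "\<one>\<^bsub>R\<^esub> \<in> J"
    unfolding p cgenideal_def carrier_eq by blast
  moreover have "ideal J R"
    using J(1) by (rule principalideal.axioms)
  ultimately show False
    using J(2) ideal.one_imp_carrier by blast
qed

section \<open>Power series with integral constant term and no linear term\<close>

definition int_no_linear_fps :: "real fps set" where
  "int_no_linear_fps = {f. fps_nth f 0 \<in> \<int> \<and> fps_nth f 1 = 0}"

text \<open>A series is encoded by its coefficient sequence. Closure under products holds because
  the linear coefficient of a product is f(0) g(1) + f(1) g(0), where f(1) and g(1) vanish.\<close>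

lemma int_no_linear_fps_copy:
  "ring_copy fps_nth int_no_linear_fps (copy_ring fps_nth int_no_linear_fps)"
  by (rule ring_copy_copy_ring) (auto simp: int_no_linear_fps_def fps_mult_nth_1 inj_def fps_eq_iff)

text \<open>Comparing linear coefficients in \<open>f * inverse f = 1\<close> forces that of the
  inverse to be 0, and its constant term is again 1.\<close>

lemma inverse_in_int_no_linear_fps:
  assumes "f \<in> int_no_linear_fps" "fps_nth f 0 = 1"
  shows "inverse f \<in> int_no_linear_fps"
proof -
  have "f * inverse f = 1"
    using assms(2) by (simp add: inverse_mult_eq_1')
  then have "fps_nth (f * inverse f) 1 = 0"
    by simp
  then show ?thesis
    using assms by (simp add: int_no_linear_fps_def fps_mult_nth_1)
qed

text \<open>This gap in the possible orders causes both the failure of primality and the missing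
  gcd. The zero series is no exception, since its \<open>subdegree\<close> is 0 by
  convention.\<close>

lemma subdegree_neq_1:
  assumes "f \<in> int_no_linear_fps"
  shows "subdegree f \<noteq> 1"
proof
  assume *: "subdegree f = 1"
  then have "f \<noteq> 0"
    by auto
  then have "fps_nth f 1 \<noteq> 0"
    using nth_subdegree_nonzero[of f] * by simp
  with assms show False
    by (simp add: int_no_linear_fps_def)
qed

lemma fps_X_power_in_int_no_linear_fps: "n \<noteq> 1 \<Longrightarrow> fps_X ^ n \<in> int_no_linear_fps"
  by (auto simp: int_no_linear_fps_def fps_X_power_nth)

lemma subdegree_factor_fps_X_power:
  fixes f g :: "real fps"
  assumes "fps_X ^ n = f * g"
  shows "subdegree f + subdegree g = n"
proof -
  have "f * g \<noteq> 0"
    using assms by (metis fps_X_neq_zero power_not_zero)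
  then show ?thesis
    using assms by (metis mult_eq_0_iff subdegree_mult fps_X_power_subdegree)
qed

section \<open>The PC property of the power series ring\<close>

lemma PC_domain_int_no_linear_fps: "PC_domain (copy_ring fps_nth int_no_linear_fps)"
proof -
  let ?R = "copy_ring fps_nth int_no_linear_fps"
  interpret ring_copy fps_nth int_no_linear_fps ?R
    by (rule int_no_linear_fps_copy)
  interpret Ring.domain ?R by (rule domain)
  have "\<exists>J. principalideal J ?R \<and> J \<noteq> carrier ?R \<and> I \<subseteq> J"
    if I: "two_generated_ideal I ?R" "I \<noteq> carrier ?R" for I
  proof -
    obtain f g where fg: "f \<in> int_no_linear_fps" "g \<in> int_no_linear_fps"
      and I_eq: "I = genideal ?R {fps_nth f, fps_nth g}"
      using I(1) unfolding two_generated_ideal_def carrier_eq by blast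
    have sub: "{fps_nth f, fps_nth g} \<subseteq> carrier ?R"
      using fg by (simp add: mem_carrier_iff)
    interpret I: ideal I ?R
      unfolding I_eq by (rule genideal_ideal[OF sub])
    have gens: "fps_nth f \<in> I" "fps_nth g \<in> I"
      using genideal_self[OF sub] by (auto simp: I_eq)
    obtain m n where mn: "fps_nth f 0 = of_int m" "fps_nth g 0 = of_int n"
      using fg by (auto simp: int_no_linear_fps_def Ints_def)
    \<comment> \<open>If the constant terms were coprime, a Bezout combination \<open>h\<close> of
      \<open>f\<close> and \<open>g\<close> would have constant term 1. It would be a unit of the
      ring lying in \<open>I\<close>.\<close>
    have gcd_neq_1: "gcd m n \<noteq> 1"
    proof
      assume "gcd m n = 1"
      then obtain u v where uv: "u * m + v * n = 1"
        using bezout_int[of m n] by auto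
      define h where "h = fps_const (of_int u) * f + fps_const (of_int v) * g"
      have const: "fps_const (of_int k) \<in> int_no_linear_fps" for k
        by (simp add: int_no_linear_fps_def)
      have "fps_nth h 0 = of_int (u * m + v * n)"
        by (simp add: h_def mn)
      then have h0: "fps_nth h 0 = 1"
        by (simp add: uv)
      have hS: "h \<in> int_no_linear_fps"
        unfolding h_def by (intro add_in mult_in const fg)
      have "fps_nth (fps_const (of_int u)) \<otimes>\<^bsub>?R\<^esub> fps_nth f \<oplus>\<^bsub>?R\<^esub>
          fps_nth (fps_const (of_int v)) \<otimes>\<^bsub>?R\<^esub> fps_nth g \<in> I"
        by (intro I.a_closed I.I_l_closed gens) (simp_all add: mem_carrier_iff const)
      then have "fps_nth h \<in> I"
        by (simp add: h_def mult_eq add_eq mult_in const fg)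
      then have "fps_nth (inverse h) \<otimes>\<^bsub>?R\<^esub> fps_nth h \<in> I"
        by (rule I.I_l_closed)
          (simp add: mem_carrier_iff inverse_in_int_no_linear_fps[OF hS h0])
      then have "\<one>\<^bsub>?R\<^esub> \<in> I"
        using hS h0 by (simp add: mult_eq one_eq inverse_in_int_no_linear_fps inverse_mult_eq_1)
      then show False
        using I(2) I.one_imp_carrier by blast
    qed
    \<comment> \<open>When both constant terms vanish their gcd is 0; the value 2 then serves as a
      nonzero nonunit dividing both.\<close>
    define d where "d = (if gcd m n = 0 then 2 else gcd m n)"
    have d: "d \<noteq> 0" "\<not> is_unit d" "d dvd m" "d dvd n"
      using gcd_neq_1 by (auto simp: d_def)
    let ?d = "fps_const (of_int d)"
    let ?J = "cgenideal ?R (fps_nth ?d)"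
    have dS: "?d \<in> int_no_linear_fps"
      by (simp add: int_no_linear_fps_def)
    have dR: "fps_nth ?d \<in> carrier ?R"
      using dS by (simp add: mem_carrier_iff)
    have mem_J: "fps_nth h \<in> ?J"
      if "h \<in> int_no_linear_fps" "fps_nth h 0 = of_int k" "d dvd k" for h k
    proof -
      obtain l where "k = d * l"
        using \<open>d dvd k\<close> by (rule dvdE)
      \<comment> \<open>Only the constant term has to stay integral under division by
        \<open>d\<close>, and it becomes \<open>l\<close>; the higher coefficients are arbitrary
        reals and the linear one remains 0.\<close>
      then have "fps_const (1 / of_int d) * h \<in> int_no_linear_fps"
        using that d(1) by (simp add: int_no_linear_fps_def)
      moreover have "h = fps_const (1 / of_int d) * h * ?d"
        using d(1) by (simp add: fps_eq_iff)
      ultimately obtain h' where "h' \<in> int_no_linear_fps" "h = h' * ?d"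
        by blast
      then have "fps_nth h' \<in> carrier ?R" "fps_nth h = fps_nth h' \<otimes>\<^bsub>?R\<^esub> fps_nth ?d"
        using dS by (simp_all add: mem_carrier_iff mult_eq)
      then show ?thesis
        unfolding cgenideal_def by blast
    qed
    have "principalideal ?J ?R"
      using dR by (rule cgenideal_is_principalideal)
    moreover have "?J \<noteq> carrier ?R"
    proof
      assume "?J = carrier ?R"
      then have "\<one>\<^bsub>?R\<^esub> \<in> ?J"
        by simp
      then obtain h where h: "h \<in> int_no_linear_fps" "1 = h * ?d"
        unfolding cgenideal_def carrier_eq one_eq by (auto simp: mult_eq dS eq_iff)
      obtain k where k: "fps_nth h 0 = of_int k"
        using h(1) by (auto simp: int_no_linear_fps_def Ints_def)
      \<comment> \<open>Constant terms reduce invertibility of \<open>?d\<close> to invertibility of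
        \<open>d\<close> among the integers.\<close>
      have "fps_nth 1 0 = fps_nth (h * ?d) 0"
        using h(2) by simp
      then have "(of_int 1 :: real) = of_int (k * d)"
        by (simp add: k)
      then have "1 = k * d"
        by (simp only: of_int_eq_iff)
      with d(2) show False
        by (metis dvd_triv_right)
    qed
    moreover have "I \<subseteq> ?J"
      unfolding I_eq
      by (rule genideal_minimal[OF cgenideal_ideal[OF dR]])
        (use mem_J fg mn d in blast)
    ultimately show ?thesis
      by blast
  qed
  then show ?thesis
    using domain by (simp add: PC_domain_def)
qed

text \<open>Two factors of X^2 can only have orders 0 and 2. The one of order 2 would have to divide
  X^3 with a cofactor of order 1, which is excluded.\<close>

lemma not_primal_int_no_linear_fps:
  "\<not> primal (copy_ring fps_nth int_no_linear_fps) (fps_nth (fps_X ^ 2))"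
proof
  let ?R = "copy_ring fps_nth int_no_linear_fps"
  interpret ring_copy fps_nth int_no_linear_fps ?R
    by (rule int_no_linear_fps_copy)
  have X: "fps_X ^ 2 \<in> int_no_linear_fps" "fps_X ^ 3 \<in> int_no_linear_fps"
      "fps_X ^ 4 \<in> int_no_linear_fps"
    by (simp_all add: fps_X_power_in_int_no_linear_fps)
  assume "primal ?R (fps_nth (fps_X ^ 2))"
  moreover have "fps_nth (fps_X ^ 3) \<in> carrier ?R"
    using X by (simp add: mem_carrier_iff)
  moreover have "fps_nth (fps_X ^ 2) divides\<^bsub>?R\<^esub> (fps_nth (fps_X ^ 3) \<otimes>\<^bsub>?R\<^esub> fps_nth (fps_X ^ 3))"
    using X by (auto simp: mult_eq divides_iff simp flip: power_add intro: bexI[of _ "fps_X ^ 4"])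
  ultimately have "\<exists>c1\<in>carrier ?R. \<exists>c2\<in>carrier ?R. fps_nth (fps_X ^ 2) = c1 \<otimes>\<^bsub>?R\<^esub> c2 \<and>
      c1 divides\<^bsub>?R\<^esub> fps_nth (fps_X ^ 3) \<and> c2 divides\<^bsub>?R\<^esub> fps_nth (fps_X ^ 3)"
    unfolding primal_def by blast
  then obtain f g where fg: "f \<in> int_no_linear_fps" "g \<in> int_no_linear_fps"
    and eq: "fps_X ^ 2 = f * g"
    and "fps_nth f divides\<^bsub>?R\<^esub> fps_nth (fps_X ^ 3)"
    and "fps_nth g divides\<^bsub>?R\<^esub> fps_nth (fps_X ^ 3)"
    unfolding carrier_eq by (auto simp: mult_eq eq_iff)
  then obtain f' g' where fg': "f' \<in> int_no_linear_fps" "g' \<in> int_no_linear_fps"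
    and eq': "fps_X ^ 3 = f * f'" "fps_X ^ 3 = g * g'"
    using divides_iff by blast
  show False
    using subdegree_factor_fps_X_power[OF eq] eq'[THEN subdegree_factor_fps_X_power]
      fg[THEN subdegree_neq_1] fg'[THEN subdegree_neq_1]
    by linarith
qed

text \<open>Both X^2 and X^3 are common divisors of X^5 and X^6, as none of the exponent differences
  is 1. A gcd would thus have order 3, 4 or 5, and each value forces some cofactor to have order
  1.\<close>

lemma not_GCD_domain_int_no_linear_fps: "\<not> GCD_domain (copy_ring fps_nth int_no_linear_fps)"
proof
  let ?R = "copy_ring fps_nth int_no_linear_fps"
  interpret ring_copy fps_nth int_no_linear_fps ?R
    by (rule int_no_linear_fps_copy)
  have X: "fps_X ^ n \<in> int_no_linear_fps" if "n \<noteq> 1" for n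
    using that by (rule fps_X_power_in_int_no_linear_fps)
  have dvd: "fps_nth (fps_X ^ m) divides\<^bsub>?R\<^esub> fps_nth (fps_X ^ n)"
    if "m \<noteq> 1" "m \<le> n" "n - m \<noteq> 1" for m n
    using that by (auto simp: divides_iff X simp flip: power_add intro!: bexI[of _ "fps_X ^ (n - m)"])
  assume "GCD_domain ?R"
  then obtain d where d: "d \<in> int_no_linear_fps"
    and gcd: "fps_nth d gcdof\<^bsub>?R\<^esub> fps_nth (fps_X ^ 5) fps_nth (fps_X ^ 6)"
    unfolding GCD_domain_def carrier_eq using X[of 5] X[of 6] by fastforce
  have "fps_nth d divides\<^bsub>?R\<^esub> fps_nth (fps_X ^ 5)" "fps_nth d divides\<^bsub>?R\<^esub> fps_nth (fps_X ^ 6)"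
    "fps_nth (fps_X ^ 2) divides\<^bsub>?R\<^esub> fps_nth d" "fps_nth (fps_X ^ 3) divides\<^bsub>?R\<^esub> fps_nth d"
    using gcd by (auto simp: isgcd_def dvd mem_carrier_iff X)
  then obtain p q r s where S: "p \<in> int_no_linear_fps" "q \<in> int_no_linear_fps"
      "r \<in> int_no_linear_fps" "s \<in> int_no_linear_fps"
    and eqs: "fps_X ^ 5 = d * p" "fps_X ^ 6 = d * q" "d = fps_X ^ 2 * r" "d = fps_X ^ 3 * s"
    by (auto simp: divides_iff d X)
  \<comment> \<open>Orders add up only for nonzero factors, so \<open>r\<close> and \<open>s\<close>
    must first be seen to be nonzero.\<close>
  have "fps_X ^ 5 \<noteq> (0::real fps)"
    by simp
  then have nz: "r \<noteq> 0" "s \<noteq> 0"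
    using eqs by auto
  have r: "subdegree d = 2 + subdegree r"
    unfolding eqs(3) using nz by (simp add: fps_X_power_subdegree)
  have s: "subdegree d = 3 + subdegree s"
    unfolding eqs(4) using nz by (simp add: fps_X_power_subdegree)
  have p: "subdegree d + subdegree p = 5" and q: "subdegree d + subdegree q = 6"
    using eqs(1,2) by (simp_all only: subdegree_factor_fps_X_power)
  \<comment> \<open>The excluded cofactors of order 1 are that of X^2 in \<open>d\<close>, then
    those of \<open>d\<close> in X^5 and in X^6.\<close>
  have "subdegree d \<noteq> 3"
    using r subdegree_neq_1[OF S(3)] by linarith
  moreover have "subdegree d \<noteq> 4"
    using p subdegree_neq_1[OF S(1)] by linarith
  moreover have "subdegree d \<noteq> 5"
    using q subdegree_neq_1[OF S(2)] by linarith
  ultimately show False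
    using p s by linarith
qed

section \<open>The two examples combined for all three properties\<close>

theorem mainTheorem4:
  shows "\<forall>P\<in>{pre_Schreier_domain, Schreier_domain, GCD_domain}.
    (\<exists>R :: (nat \<Rightarrow> real) ring. PC_domain R \<and> \<not> P R) \<and>
    (\<exists>R :: (nat \<Rightarrow> real) ring. domain R \<and> P R \<and> \<not> PC_domain R)"
proof -
  let ?A = "copy_ring fps_nth int_no_linear_fps"
  \<comment> \<open>Integer coefficients are read as reals so that both examples have the same
    element type.\<close>
  let ?e = "\<lambda>(p :: int poly) n. real_of_int (Polynomial.coeff p n)"
  let ?B = "copy_ring ?e UNIV"
  interpret A: ring_copy fps_nth int_no_linear_fps ?A
    by (rule int_no_linear_fps_copy)
  have "fps_nth (fps_X ^ 2) \<in> carrier ?A"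
    by (simp add: A.mem_carrier_iff fps_X_power_in_int_no_linear_fps)
  then have A: "\<not> pre_Schreier_domain ?A" "\<not> Schreier_domain ?A"
    using not_primal_int_no_linear_fps by (auto simp: pre_Schreier_domain_def Schreier_domain_def)
  have "inj ?e"
    by (auto simp: inj_def poly_eq_iff fun_eq_iff)
  then interpret B: gcd_ring_copy ?e ?B
    unfolding gcd_ring_copy_def by (rule ring_copy_copy_ring) auto
  show ?thesis
    using A PC_domain_int_no_linear_fps not_GCD_domain_int_no_linear_fps
      B.domain B.pre_Schreier_domain B.Schreier_domain B.GCD_domain
      not_PC_domain_int_poly[OF B.gcd_ring_copy_axioms]
    by blast
qed

end
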